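(* Let $u<v$ in $S_n$ (strong Bruhat order), and let $(i\,j)$ be a transposition which is inversion-minimal on $(u,v)$. Then $u \leq v(i\,j) \lessdot v$ and $u \lessdot u(i\,j) \leq v$.
   Context: $S_n$ carries the (strong) Bruhat order $\leq$; $x \lessdot y$ denotes a cover relation. A permutation $w$ is written in one-line notation as $w_1w_2\cdots w_n$ with $w_i=w(i)$, and products are composed as functions, so that $w(i\,k)$ is obtained from $w$ by swapping the entries in positions $i$ and $k$. For $u,v\in S_n$, a transposition $(i\,k)$ with $i<k$ is called inversion-minimal on $(u,v)$ if $v_i>v_k$ and $u_i<u_k$, and the interval $[i,k]$ is minimal with respect to inclusion with this property, i.e. there is no proper subinterval $[p,q]\subsetneq[i,k]$, $p<q$, with $v_p>v_q$ and $u_p<u_q$. *)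

theory Defs
  imports "HOL-Combinatorics.Permutations"
begin

text \<open>
  The symmetric group \<open>S_n\<close> is the set of functions \<open>w :: nat \<Rightarrow> nat\<close> with \<open>w permutes {1..n}\<close>;
  \<open>w i\<close> is the entry in position \<open>i\<close> of the one-line notation. Products are compositions of
  functions, so \<open>w \<circ> transpose i k\<close> swaps the entries in positions \<open>i\<close> and \<open>k\<close>.
\<close>

definition inversions :: "nat \<Rightarrow> (nat \<Rightarrow> nat) \<Rightarrow> (nat \<times> nat) set" where
  "inversions n w = {(i, k). 1 \<le> i \<and> i < k \<and> k \<le> n \<and> w i > w k}"

text \<open>The Coxeter length of a permutation is its number of inversions.\<close>

definition perm_length :: "nat \<Rightarrow> (nat \<Rightarrow> nat) \<Rightarrow> nat" where
  "perm_length n w = card (inversions n w)"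

text \<open>
  The strong Bruhat order on \<open>S_n\<close> is the reflexive transitive closure of the Bruhat graph:
  \<open>u \<rightarrow> u t\<close> for any transposition \<open>t\<close> (not only adjacent ones) that increases the length.
\<close>

definition bruhat_edge :: "nat \<Rightarrow> (nat \<Rightarrow> nat) \<Rightarrow> (nat \<Rightarrow> nat) \<Rightarrow> bool" where
  "bruhat_edge n u v \<longleftrightarrow> u permutes {1..n} \<and>
     (\<exists>i k. 1 \<le> i \<and> i < k \<and> k \<le> n \<and> v = u \<circ> transpose i k) \<and>
     perm_length n u < perm_length n v"

definition bruhat_le :: "nat \<Rightarrow> (nat \<Rightarrow> nat) \<Rightarrow> (nat \<Rightarrow> nat) \<Rightarrow> bool" where
  "bruhat_le n u v \<longleftrightarrow> u permutes {1..n} \<and> v permutes {1..n} \<and> (bruhat_edge n)\<^sup>*\<^sup>* u v"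

definition bruhat_less :: "nat \<Rightarrow> (nat \<Rightarrow> nat) \<Rightarrow> (nat \<Rightarrow> nat) \<Rightarrow> bool" where
  "bruhat_less n u v \<longleftrightarrow> bruhat_le n u v \<and> u \<noteq> v"

definition bruhat_covers :: "nat \<Rightarrow> (nat \<Rightarrow> nat) \<Rightarrow> (nat \<Rightarrow> nat) \<Rightarrow> bool" where
  "bruhat_covers n x y \<longleftrightarrow>
     bruhat_less n x y \<and> (\<nexists>z. bruhat_less n x z \<and> bruhat_less n z y)"

definition inversion_minimal ::
  "nat \<Rightarrow> (nat \<Rightarrow> nat) \<Rightarrow> (nat \<Rightarrow> nat) \<Rightarrow> nat \<Rightarrow> nat \<Rightarrow> bool" where
  "inversion_minimal n u v i k \<longleftrightarrow>
     1 \<le> i \<and> i < k \<and> k \<le> n \<and> v i > v k \<and> u i < u k \<and>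
     \<not> (\<exists>p q. p < q \<and> {p..q} \<subset> {i..k} \<and> v p > v q \<and> u p < u q)"

end

theory Submission
  imports Defs
begin

text \<open>
  The proof replaces the Bruhat order by a counting criterion: \<open>u \<le> v\<close> if and only if every
  prefix of \<open>v\<close> has, for every threshold \<open>q\<close>, at least as many entries \<open>\<ge> q\<close> as the same prefix of
  \<open>u\<close> (predicate \<open>dominated\<close>). Swapping entries \<open>w\<^sub>i < w\<^sub>k\<close> in positions \<open>i < k\<close> raises this count by
  one for the prefixes ending in \<open>{i..<k}\<close> and the thresholds in \<open>{w\<^sub>i<..w\<^sub>k}\<close>, and changes nothing
  else (\<open>count_ge_swap\<close>). So \<open>u (i j) \<le> v\<close> says that the counts of \<open>u\<close> and \<open>v\<close> differ strictly on the
  rectangle \<open>{i..<j} \<times> {u\<^sub>i<..u\<^sub>j}\<close>, and \<open>u \<le> v (i j)\<close> that they do so on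
  \<open>{i..<j} \<times> {v\<^sub>j<..v\<^sub>i}\<close>.

  Inversion-minimality supplies this strictness, because it splits the positions strictly between
  \<open>i\<close> and \<open>j\<close> into high ones, where the entries of \<open>u\<close> and \<open>v\<close> exceed \<open>u\<^sub>j\<close> and \<open>v\<^sub>i\<close>, and low
  ones, where they lie below \<open>u\<^sub>i\<close> and \<open>v\<^sub>j\<close> (\<open>inversion_minimal_dichotomy\<close>). On the positions
  \<open>{i..p}\<close> the permutation \<open>v\<close> therefore gains on \<open>u\<close> if \<open>u\<^sub>i < q \<le> v\<^sub>i\<close>, and on \<open>{p<..j}\<close> it loses
  against \<open>u\<close> if \<open>v\<^sub>j < q \<le> u\<^sub>j\<close>. One of the two always applies. In the first case one compares the
  prefix ending at \<open>p\<close> with the one ending just before \<open>i\<close>, in the second with the one ending at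
  \<open>j\<close> (\<open>dominated_strict\<close>).

  The dichotomy also excludes an entry strictly between the two swapped values, so that the length
  changes by exactly one and the swaps are covers. Finally, the counting argument itself proves the
  nontrivial half of the criterion: if \<open>u\<close> is dominated by \<open>v \<noteq> u\<close>, there is an inversion-minimal
  transposition, and applying it to \<open>u\<close> moves up in the Bruhat graph while staying dominated by \<open>v\<close>
  (\<open>dominated_imp_bruhat_le\<close>).
\<close>

section \<open>Transpositions and length\<close>

lemma swap_permutes:
  fixes n :: nat
  assumes "w permutes {1..n}" "1 \<le> i" "i < k" "k \<le> n"
  shows "w \<circ> transpose i k permutes {1..n}"
  using assms by (intro permutes_compose permutes_swap_id) auto

lemma finite_inversions: "finite (inversions n w)"
  by (rule finite_subset[of _ "{1..n} \<times> {1..n}"]) (auto simp: inversions_def)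

lemma perm_length_le_square: "perm_length n w \<le> n * n"
proof -
  have "card (inversions n w) \<le> card ({1..n} \<times> {1..n})"
    by (rule card_mono) (auto simp: inversions_def)
  then show ?thesis by (simp add: perm_length_def card_cartesian_product)
qed

text \<open>
  Applying the transposition to both positions of a pair does not always give an increasing pair.
  Leaving the pair alone in that case gives an involution on increasing pairs.
\<close>

definition transpose_pair :: "nat \<Rightarrow> nat \<Rightarrow> nat \<times> nat \<Rightarrow> nat \<times> nat" where
  "transpose_pair i k = (\<lambda>(a, b).
     if transpose i k a < transpose i k b then (transpose i k a, transpose i k b) else (a, b))"

lemma transpose_pair_involution:
  "a < b \<Longrightarrow> transpose_pair i k (transpose_pair i k (a, b)) = (a, b)"
  by (auto simp: transpose_pair_def)

text \<open>
  If a swap of \<open>w\<^sub>i < w\<^sub>k\<close> reverses the order of two positions, then one of them is \<open>i\<close> or \<open>k\<close> and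
  the other lies in between. An inversion there persists, since position \<open>i\<close> receives a larger and
  position \<open>k\<close> a smaller entry.
\<close>

lemma transpose_pair_inversions:
  assumes "1 \<le> i" "i < k" "k \<le> n" "w i < w k"
  shows "transpose_pair i k ` inversions n w \<subseteq> inversions n (w \<circ> transpose i k) - {(i, k)}"
  using assms
  by (auto simp: transpose_pair_def inversions_def transpose_def split: if_splits)

lemma inj_on_transpose_pair: "inj_on (transpose_pair i k) (inversions n w)"
  by (rule inj_on_inverseI[of _ "transpose_pair i k"])
     (auto simp: inversions_def transpose_pair_involution)

lemma swapped_pair_inversion:
  assumes "1 \<le> i" "i < k" "k \<le> n" "w i < w k"
  shows "(i, k) \<in> inversions n (w \<circ> transpose i k)"
  using assms by (auto simp: inversions_def)

lemma perm_length_swap_less: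
  assumes "1 \<le> i" "i < k" "k \<le> n" "w i < w k"
  shows "perm_length n w < perm_length n (w \<circ> transpose i k)"
proof -
  let ?J = "inversions n (w \<circ> transpose i k)"
  have "card (inversions n w) = card (transpose_pair i k ` inversions n w)"
    by (simp add: card_image inj_on_transpose_pair)
  also have "\<dots> \<le> card (?J - {(i, k)})"
    by (intro card_mono transpose_pair_inversions assms) (simp add: finite_inversions)
  also have "\<dots> < card ?J"
    using swapped_pair_inversion[OF assms] finite_inversions by (rule card_Diff1_less[rotated])
  finally show ?thesis by (simp add: perm_length_def)
qed

text \<open>
  Without an entry between the swapped values, the converse of the persistence argument holds too,
  so that the swap creates only the inversion \<open>(i, k)\<close>.
\<close>

lemma perm_length_swap_Suc:
  assumes "inj w" and ik: "1 \<le> i" "i < k" "k \<le> n" "w i < w k"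
    and gap: "\<And>m. i < m \<Longrightarrow> m < k \<Longrightarrow> \<not> (w i < w m \<and> w m < w k)"
  shows "perm_length n (w \<circ> transpose i k) = Suc (perm_length n w)"
proof -
  let ?J = "inversions n (w \<circ> transpose i k)"
  have preimage: "transpose_pair i k x \<in> inversions n w" if x: "x \<in> ?J - {(i, k)}" for x
  proof -
    obtain a b where ab: "x = (a, b)" by (cases x)
    have x': "1 \<le> a" "a < b" "b \<le> n" "w (transpose i k b) < w (transpose i k a)" "\<not> (a = i \<and> b = k)"
      using x by (auto simp: ab inversions_def)
    show ?thesis
    proof (cases "transpose i k a < transpose i k b")
      case True
      moreover have "1 \<le> transpose i k a" "transpose i k b \<le> n"
        using x' ik by (auto simp: transpose_def)
      ultimately show ?thesis using x' by (simp add: ab transpose_pair_def inversions_def)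
    next
      case False
      then consider "a = i" "i < b" "b < k" | "b = k" "i < a" "a < k"
        using x' ik by (auto simp: transpose_def split: if_splits)
      then have "w b < w a"
      proof cases
        case 1
        then have "w b < w k" using x' by simp
        moreover have "w b \<noteq> w i" using 1 \<open>inj w\<close> by (auto dest: injD)
        ultimately show ?thesis using gap[of b] 1 by auto
      next
        case 2
        then have "w i < w a" using x' by simp
        moreover have "w a \<noteq> w k" using 2 \<open>inj w\<close> by (auto dest: injD)
        ultimately show ?thesis using gap[of a] 2 by auto
      qed
      then show ?thesis using x' False by (simp add: ab transpose_pair_def inversions_def)
    qed
  qed
  have "transpose_pair i k ` inversions n w = ?J - {(i, k)}"
  proof
    show "?J - {(i, k)} \<subseteq> transpose_pair i k ` inversions n w"
    proof
      fix x assume x: "x \<in> ?J - {(i, k)}"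
      then have "x = transpose_pair i k (transpose_pair i k x)"
        by (cases x) (auto simp: inversions_def transpose_pair_involution)
      then show "x \<in> transpose_pair i k ` inversions n w" using preimage[OF x] by (rule image_eqI)
    qed
  qed (rule transpose_pair_inversions[OF ik])
  then have "card (inversions n w) = card (?J - {(i, k)})"
    using card_image[OF inj_on_transpose_pair, of i k n w] by simp
  also have "Suc \<dots> = card ?J"
    using swapped_pair_inversion[OF ik] finite_inversions by (intro card_Suc_Diff1) auto
  finally show ?thesis unfolding perm_length_def by (rule sym)
qed

section \<open>Edges and covers of the Bruhat order\<close>

lemma bruhat_edge_swap:
  assumes "w permutes {1..n}" "1 \<le> i" "i < k" "k \<le> n" "w i < w k"
  shows "bruhat_edge n w (w \<circ> transpose i k)"
  using assms perm_length_swap_less[of i k n w] by (auto simp: bruhat_edge_def)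

lemma bruhat_edgeE:
  assumes "bruhat_edge n u v"
  obtains i k where "1 \<le> i" "i < k" "k \<le> n" "u i < u k" "v = u \<circ> transpose i k"
proof -
  from assms obtain i k where ik: "1 \<le> i" "i < k" "k \<le> n" and v: "v = u \<circ> transpose i k"
    and u: "u permutes {1..n}" and len: "perm_length n u < perm_length n v"
    by (auto simp: bruhat_edge_def)
  have "u i \<noteq> u k" using u ik by (auto dest: permutes_inj injD)
  moreover have "\<not> u k < u i"
  proof
    assume "u k < u i"
    then have "perm_length n v < perm_length n (v \<circ> transpose i k)"
      using ik v by (intro perm_length_swap_less) auto
    then show False using len v by (simp add: comp_assoc)
  qed
  ultimately show thesis using that ik v by force
qed

lemma bruhat_less_perm_length:
  assumes "bruhat_less n u v"
  shows "perm_length n u < perm_length n v"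
proof -
  have "(bruhat_edge n)\<^sup>+\<^sup>+ u v"
    using assms by (auto simp: bruhat_less_def bruhat_le_def rtranclp_into_tranclp2 dest: rtranclpD)
  then show ?thesis
    by (induction rule: tranclp_induct) (auto simp: bruhat_edge_def)
qed

lemma bruhat_covers_swap:
  assumes w: "w permutes {1..n}" and ik: "1 \<le> i" "i < k" "k \<le> n" "w i < w k"
    and gap: "\<And>m. i < m \<Longrightarrow> m < k \<Longrightarrow> \<not> (w i < w m \<and> w m < w k)"
  shows "bruhat_covers n w (w \<circ> transpose i k)"
proof -
  have len: "perm_length n (w \<circ> transpose i k) = Suc (perm_length n w)"
    using permutes_inj[OF w] ik gap by (rule perm_length_swap_Suc)
  have "bruhat_less n w (w \<circ> transpose i k)"
    using bruhat_edge_swap[OF w ik] swap_permutes[OF w ik(1-3)] w len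
    by (auto simp: bruhat_less_def bruhat_le_def)
  moreover have "\<not> (bruhat_less n w z \<and> bruhat_less n z (w \<circ> transpose i k))" for z
    using bruhat_less_perm_length[of n w z] bruhat_less_perm_length[of n z "w \<circ> transpose i k"] len
    by linarith
  ultimately show ?thesis by (auto simp: bruhat_covers_def)
qed

section \<open>The counting criterion\<close>

definition count_ge :: "(nat \<Rightarrow> nat) \<Rightarrow> nat set \<Rightarrow> nat \<Rightarrow> nat" where
  "count_ge w A q = card {a \<in> A. q \<le> w a}"

definition dominated :: "(nat \<Rightarrow> nat) \<Rightarrow> (nat \<Rightarrow> nat) \<Rightarrow> bool" where
  "dominated u v \<longleftrightarrow> (\<forall>p q. count_ge u {1..p} q \<le> count_ge v {1..p} q)"

lemma count_ge_union:
  assumes "finite A" "finite B" "A \<inter> B = {}"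
  shows "count_ge w (A \<union> B) q = count_ge w A q + count_ge w B q"
proof -
  have "{a \<in> A \<union> B. q \<le> w a} = {a \<in> A. q \<le> w a} \<union> {a \<in> B. q \<le> w a}" by auto
  moreover have "card \<dots> = card {a \<in> A. q \<le> w a} + card {a \<in> B. q \<le> w a}"
    using assms by (intro card_Un_disjoint) auto
  ultimately show ?thesis by (simp add: count_ge_def)
qed

lemma count_ge_prefix_split:
  assumes "p \<le> r"
  shows "count_ge w {1..r} q = count_ge w {1..p} q + count_ge w {p<..r} q"
proof -
  have "{1..r} = {1..p} \<union> {p<..r}" using assms by auto
  then show ?thesis by (simp add: count_ge_union[symmetric] ivl_disj_int)
qed

lemma count_ge_less:
  assumes "finite A" and "\<And>a. a \<in> A \<Longrightarrow> q \<le> x a \<Longrightarrow> q \<le> y a"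
    and "b \<in> A" "x b < q" "q \<le> y b"
  shows "count_ge x A q < count_ge y A q"
proof -
  have "{a \<in> A. q \<le> x a} \<subset> {a \<in> A. q \<le> y a}"
  proof
    show "{a \<in> A. q \<le> x a} \<subseteq> {a \<in> A. q \<le> y a}" using assms(2) by blast
    have "b \<in> {a \<in> A. q \<le> y a}" "b \<notin> {a \<in> A. q \<le> x a}" using assms(3-5) by auto
    then show "{a \<in> A. q \<le> x a} \<noteq> {a \<in> A. q \<le> y a}" by blast
  qed
  then show ?thesis unfolding count_ge_def using assms(1) by (intro psubset_card_mono) auto
qed

text \<open>
  Prefixes that contain both or none of the positions \<open>i\<close> and \<open>k\<close> keep their multiset of entries.
  The others lose \<open>w\<^sub>i\<close> and receive \<open>w\<^sub>k\<close>.
\<close>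

lemma count_ge_swap:
  assumes "1 \<le> i" "i < k" "w i < w k"
  shows "count_ge (w \<circ> transpose i k) {1..p} q =
    count_ge w {1..p} q + of_bool (i \<le> p \<and> p < k \<and> w i < q \<and> q \<le> w k)"
proof -
  let ?t = "transpose i k"
  consider "p < i" | "i \<le> p" "p < k" | "k \<le> p" by linarith
  then show ?thesis
  proof cases
    case 1
    then have "{a \<in> {1..p}. q \<le> (w \<circ> ?t) a} = {a \<in> {1..p}. q \<le> w a}"
      using assms by (auto simp: transpose_def)
    then show ?thesis using 1 by (simp add: count_ge_def)
  next
    case 2
    have ins: "{1..p} = {i} \<union> ({1..p} - {i})" using 2 assms by auto
    have "count_ge x {1..p} q = of_bool (q \<le> x i) + count_ge x ({1..p} - {i}) q" for x
    proof -
      have "count_ge x {1..p} q = count_ge x {i} q + count_ge x ({1..p} - {i}) q"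
        by (subst ins, rule count_ge_union) auto
      moreover have "{a \<in> {i}. q \<le> x a} = (if q \<le> x i then {i} else {})" by auto
      ultimately show ?thesis by (simp add: count_ge_def)
    qed
    from this[of w] this[of "w \<circ> ?t"]
    have "count_ge w {1..p} q = of_bool (q \<le> w i) + count_ge w ({1..p} - {i}) q"
      "count_ge (w \<circ> ?t) {1..p} q = of_bool (q \<le> w k) + count_ge (w \<circ> ?t) ({1..p} - {i}) q"
      by simp_all
    moreover have "{a \<in> {1..p} - {i}. q \<le> (w \<circ> ?t) a} = {a \<in> {1..p} - {i}. q \<le> w a}"
      using 2 by (auto simp: transpose_def)
    then have "count_ge (w \<circ> ?t) ({1..p} - {i}) q = count_ge w ({1..p} - {i}) q"
      by (simp add: count_ge_def)
    ultimately show ?thesis using 2 assms by auto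
  next
    case 3
    have maps: "?t a \<in> {1..p}" if "a \<in> {1..p}" for a
      using 3 assms that by (auto simp: transpose_def)
    have "{a \<in> {1..p}. q \<le> (w \<circ> ?t) a} = ?t ` {a \<in> {1..p}. q \<le> w a}"
    proof (intro equalityI subsetI)
      fix a assume "a \<in> {a \<in> {1..p}. q \<le> (w \<circ> ?t) a}"
      then show "a \<in> ?t ` {a \<in> {1..p}. q \<le> w a}"
        using maps[of a] by (intro image_eqI[of _ _ "?t a"]) auto
    next
      fix a assume "a \<in> ?t ` {a \<in> {1..p}. q \<le> w a}"
      then show "a \<in> {a \<in> {1..p}. q \<le> (w \<circ> ?t) a}" using maps by force
    qed
    then show ?thesis using 3 by (simp add: count_ge_def card_image)
  qed
qed

lemma bruhat_le_imp_dominated: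
  assumes "bruhat_le n u v"
  shows "dominated u v"
proof -
  have "(bruhat_edge n)\<^sup>*\<^sup>* u v" using assms by (simp add: bruhat_le_def)
  then show ?thesis
  proof (induction rule: rtranclp_induct)
    case base
    show ?case by (simp add: dominated_def)
  next
    case (step y z)
    from step(2) obtain i k where "1 \<le> i" "i < k" "y i < y k" "z = y \<circ> transpose i k"
      by (rule bruhat_edgeE)
    then have "dominated y z" unfolding dominated_def by (metis count_ge_swap le_add1)
    with step.IH show ?case unfolding dominated_def by (meson order_trans)
  qed
qed

section \<open>Inversion-minimal transpositions\<close>

text \<open>
  Minimality says that \<open>u\<^sub>a < u\<^sub>b\<close> forces \<open>v\<^sub>a < v\<^sub>b\<close> for \<open>i \<le> a < b \<le> j\<close> other than \<open>(i, j)\<close>. An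
  entry of \<open>u\<close> between \<open>u\<^sub>i\<close> and \<open>u\<^sub>j\<close> would thus give \<open>v\<^sub>i < v\<^sub>m < v\<^sub>j\<close>, contrary to
  \<open>v\<^sub>i > v\<^sub>j\<close>. An entry above both is compared with position \<open>i\<close>, and an entry below both with
  position \<open>j\<close>.
\<close>

lemma inversion_minimal_dichotomy:
  assumes "inj u" "inj v" and min: "inversion_minimal n u v i j" and m: "i < m" "m < j"
  shows "u j < u m \<and> v i < v m \<or> u m < u i \<and> v m < v j"
proof -
  have "{i..m} \<subset> {i..j}" "{m..j} \<subset> {i..j}" using m by auto
  then have "\<not> (v i > v m \<and> u i < u m)" "\<not> (v m > v j \<and> u m < u j)"
    using min m unfolding inversion_minimal_def by blast+
  moreover have "v i > v j" "u i < u j" using min by (auto simp: inversion_minimal_def)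
  moreover have "u i \<noteq> u m" "u m \<noteq> u j" "v i \<noteq> v m" "v m \<noteq> v j"
    using assms by (auto dest: injD)
  ultimately show ?thesis by linarith
qed

text \<open>
  The hypothesis on \<open>q\<close> is weaker than membership in the threshold range of either swap, so that
  this lemma serves both \<open>u (i j) \<le> v\<close> and \<open>u \<le> v (i j)\<close>.
\<close>

lemma dominated_strict:
  assumes dom: "dominated u v"
    and dich: "\<And>m. i < m \<Longrightarrow> m < j \<Longrightarrow> u j < u m \<and> v i < v m \<or> u m < u i \<and> v m < v j"
    and p: "1 \<le> i" "i \<le> p" "p < j"
    and q: "u i < q \<and> q \<le> v i \<or> v j < q \<and> q \<le> u j"
  shows "count_ge u {1..p} q < count_ge v {1..p} q"
  using q
proof
  assume q: "u i < q \<and> q \<le> v i"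
  have "q \<le> v a" if a: "a \<in> {i - 1<..p}" "q \<le> u a" for a
  proof (cases "a = i")
    case False
    then have "i < a" "a < j" using a p by auto
    then show ?thesis using dich[of a] a p q by auto
  qed (use q in auto)
  then have "count_ge u {i - 1<..p} q < count_ge v {i - 1<..p} q"
    using p q by (intro count_ge_less[of _ _ _ _ i]) auto
  moreover have "count_ge u {1..i - 1} q \<le> count_ge v {1..i - 1} q"
    using dom by (simp add: dominated_def)
  ultimately show ?thesis
    using p count_ge_prefix_split[of "i - 1" p] by simp
next
  assume q: "v j < q \<and> q \<le> u j"
  have "q \<le> u a" if a: "a \<in> {p<..j}" "q \<le> v a" for a
  proof (cases "a = j")
    case False
    then show ?thesis using dich[of a] a p q by auto
  qed (use q in auto)
  then have "count_ge v {p<..j} q < count_ge u {p<..j} q"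
    using p q by (intro count_ge_less[of _ _ _ _ j]) auto
  moreover have "count_ge u {1..j} q \<le> count_ge v {1..j} q"
    using dom by (simp add: dominated_def)
  ultimately show ?thesis
    using p count_ge_prefix_split[of p j] by simp
qed

lemma dominated_swap_lower:
  assumes "inj u" "inj v" and dom: "dominated u v" and min: "inversion_minimal n u v i j"
  shows "dominated (u \<circ> transpose i j) v"
  unfolding dominated_def
proof (intro allI)
  fix p q
  have ij: "1 \<le> i" "i < j" "u i < u j" "v j < v i"
    using min by (auto simp: inversion_minimal_def)
  have "count_ge u {1..p} q < count_ge v {1..p} q"
    if pq: "i \<le> p \<and> p < j \<and> u i < q \<and> q \<le> u j"
  proof (rule dominated_strict[OF dom inversion_minimal_dichotomy[OF assms(1,2) min]])
    show "u i < q \<and> q \<le> v i \<or> v j < q \<and> q \<le> u j" using pq ij by linarith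
  qed (use pq ij in auto)
  moreover have "count_ge u {1..p} q \<le> count_ge v {1..p} q"
    using dom by (simp add: dominated_def)
  ultimately show "count_ge (u \<circ> transpose i j) {1..p} q \<le> count_ge v {1..p} q"
    using count_ge_swap[of i j u p q] ij by (auto simp: of_bool_def)
qed

lemma dominated_swap_upper:
  assumes "inj u" "inj v" and dom: "dominated u v" and min: "inversion_minimal n u v i j"
  shows "dominated u (v \<circ> transpose i j)"
  unfolding dominated_def
proof (intro allI)
  fix p q
  let ?v = "v \<circ> transpose i j"
  have ij: "1 \<le> i" "i < j" "u i < u j" "v j < v i"
    using min by (auto simp: inversion_minimal_def)
  have "count_ge u {1..p} q < count_ge v {1..p} q"
    if pq: "i \<le> p \<and> p < j \<and> v j < q \<and> q \<le> v i"
  proof (rule dominated_strict[OF dom inversion_minimal_dichotomy[OF assms(1,2) min]])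
    show "u i < q \<and> q \<le> v i \<or> v j < q \<and> q \<le> u j" using pq ij by linarith
  qed (use pq ij in auto)
  moreover have "count_ge u {1..p} q \<le> count_ge v {1..p} q"
    using dom by (simp add: dominated_def)
  moreover have "?v \<circ> transpose i j = v" by (simp add: comp_assoc)
  then have "count_ge v {1..p} q =
      count_ge ?v {1..p} q + of_bool (i \<le> p \<and> p < j \<and> v j < q \<and> q \<le> v i)"
    using count_ge_swap[of i j ?v p q] ij by simp
  ultimately show "count_ge u {1..p} q \<le> count_ge ?v {1..p} q"
    by (auto simp: of_bool_def split: if_splits)
qed

section \<open>Domination implies Bruhat order\<close>

text \<open>
  At the first position \<open>a\<close> where the permutations differ, domination forces \<open>u\<^sub>a < v\<^sub>a\<close>. Beyond
  \<open>a\<close> the permutation \<open>u\<close> has one entry \<open>\<le> u\<^sub>a\<close> fewer than \<open>v\<close>, since it has spent \<open>u\<^sub>a\<close> itself at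
  \<open>a\<close>. Hence some \<open>k > a\<close> satisfies \<open>v\<^sub>k \<le> u\<^sub>a < u\<^sub>k\<close>.
\<close>

lemma dominated_imp_ex_inversion:
  fixes u v :: "nat \<Rightarrow> nat"
  assumes u: "u permutes {1..n}" and v: "v permutes {1..n}"
    and dom: "dominated u v" and "u \<noteq> v"
  shows "\<exists>i k. 1 \<le> i \<and> i < k \<and> k \<le> n \<and> v i > v k \<and> u i < u k"
proof -
  define a where "a = (LEAST a. u a \<noteq> v a)"
  have "\<exists>b. u b \<noteq> v b" using \<open>u \<noteq> v\<close> by blast
  then have ne: "u a \<noteq> v a" unfolding a_def by (rule LeastI_ex)
  have eq: "u b = v b" if "b < a" for b using not_less_Least[of b] that unfolding a_def by blast
  have "a \<in> {1..n}"
    using ne permutes_not_in[OF u, of a] permutes_not_in[OF v, of a] by (cases "a \<in> {1..n}") auto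
  then have an: "1 \<le> a" "a \<le> n" by auto
  have lt: "u a < v a"
  proof (rule ccontr)
    assume "\<not> u a < v a"
    then have less: "v a < u a" using ne by simp
    have "u a \<le> u b" if "b \<in> {1..a}" "u a \<le> v b" for b
      using that eq[of b] by (cases "b = a") auto
    then have "count_ge v {1..a} (u a) < count_ge u {1..a} (u a)"
      using less an by (intro count_ge_less[of _ _ _ _ a]) auto
    then show False using dom unfolding dominated_def by (meson not_le)
  qed
  have "\<exists>k \<in> {a<..n}. v k \<le> u a \<and> u a < u k"
  proof (rule ccontr)
    assume "\<not> (\<exists>k \<in> {a<..n}. v k \<le> u a \<and> u a < u k)"
    then have no: "u k \<le> u a" if "a < k" "k \<le> n" "v k \<le> u a" for k
      using that by (meson greaterThanAtMost_iff not_le)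
    let ?U = "{k \<in> {1..n}. u k \<le> u a}" and ?V = "{k \<in> {1..n}. v k \<le> u a}"
    have card_le: "card {k \<in> {1..n}. w k \<le> u a} = card {x \<in> {1..n}. x \<le> u a}"
      if "w permutes {1..n}" for w
    proof -
      have "w ` {k \<in> {1..n}. w k \<le> u a} = {x \<in> {1..n}. x \<le> u a}"
      proof (intro equalityI subsetI)
        fix x assume "x \<in> w ` {k \<in> {1..n}. w k \<le> u a}"
        then show "x \<in> {x \<in> {1..n}. x \<le> u a}" using permutes_in_image[OF that] by fast
      next
        fix x assume x: "x \<in> {x \<in> {1..n}. x \<le> u a}"
        then have "x \<in> w ` {1..n}" using permutes_image[OF that] by simp
        then obtain k where "k \<in> {1..n}" "x = w k" by blast
        then show "x \<in> w ` {k \<in> {1..n}. w k \<le> u a}" using x by blast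
      qed
      moreover have "card (w ` {k \<in> {1..n}. w k \<le> u a}) = card {k \<in> {1..n}. w k \<le> u a}"
        by (rule card_image[OF permutes_inj_on[OF that]])
      ultimately show ?thesis by simp
    qed
    have "u k \<le> u a" if "k \<in> ?V" for k
    proof -
      consider "k < a" | "k = a" | "a < k" by linarith
      then show ?thesis
      proof cases
        case 1
        then show ?thesis using that eq[of k] by simp
      next
        case 3
        then show ?thesis using that no[of k] by simp
      qed simp
    qed
    then have "?V \<subseteq> ?U" by blast
    moreover have "a \<in> ?U" "a \<notin> ?V" using lt an by auto
    ultimately have "?V \<subset> ?U" by blast
    then have "card ?V < card ?U" by (intro psubset_card_mono) auto
    then show False using card_le[OF u] card_le[OF v] by simp
  qed
  then show ?thesis using lt an by force
qed

lemma ex_inversion_minimal: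
  assumes "1 \<le> i" "i < k" "k \<le> n" "v i > v k" "u i < u k"
  shows "\<exists>i k. inversion_minimal n u v i k"
  using assms
proof (induction "k - i" arbitrary: i k rule: less_induct)
  case less
  show ?case
  proof (cases "inversion_minimal n u v i k")
    case False
    then obtain p q where pq: "p < q" "{p..q} \<subset> {i..k}" "v p > v q" "u p < u q"
      using less.prems by (auto simp: inversion_minimal_def)
    then have "i \<le> p" "q \<le> k" "\<not> (p = i \<and> q = k)" by auto
    then show ?thesis using less.hyps[of q p] less.prems pq by force
  qed auto
qed

text \<open>
  Climbing from \<open>u\<close> by inversion-minimal swaps never leaves the permutations dominated by \<open>v\<close>, and
  the length, bounded by \<open>n\<^sup>2\<close>, grows at each step. The climb can only stop at \<open>v\<close>.
\<close>

lemma dominated_imp_bruhat_le: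
  assumes "u permutes {1..n}" "v permutes {1..n}" "dominated u v"
  shows "bruhat_le n u v"
  using assms(1,3)
proof (induction "n * n - perm_length n u" arbitrary: u rule: less_induct)
  case less
  show ?case
  proof (cases "u = v")
    case True
    then show ?thesis using assms(2) by (simp add: bruhat_le_def)
  next
    case False
    obtain i k where ik: "inversion_minimal n u v i k"
      using dominated_imp_ex_inversion[OF less.prems(1) assms(2) less.prems(2) False]
        ex_inversion_minimal by blast
    then have b: "1 \<le> i" "i < k" "k \<le> n" "u i < u k" by (auto simp: inversion_minimal_def)
    let ?u = "u \<circ> transpose i k"
    have edge: "bruhat_edge n u ?u" using less.prems b by (intro bruhat_edge_swap)
    have "dominated ?u v"
      using less.prems assms(2) ik by (intro dominated_swap_lower permutes_inj)
    moreover have "n * n - perm_length n ?u < n * n - perm_length n u"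
      using perm_length_swap_less[of i k n u, OF b] perm_length_le_square[of n ?u] by linarith
    ultimately have "bruhat_le n ?u v"
      using less.hyps swap_permutes[OF less.prems(1) b(1-3)] by blast
    then show ?thesis
      using edge less.prems by (auto simp: bruhat_le_def intro: converse_rtranclp_into_rtranclp)
  qed
qed

theorem theorem3p3:
  fixes n :: nat and u v :: "nat \<Rightarrow> nat" and i j :: nat
  assumes "u permutes {1..n}" and "v permutes {1..n}"
    and "bruhat_less n u v"
    and "inversion_minimal n u v i j"
  shows "bruhat_le n u (v \<circ> transpose i j) \<and> bruhat_covers n (v \<circ> transpose i j) v
       \<and> bruhat_covers n u (u \<circ> transpose i j) \<and> bruhat_le n (u \<circ> transpose i j) v"
proof -
  have ij: "1 \<le> i" "i < j" "j \<le> n" "u i < u j" "v j < v i"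
    using assms(4) by (auto simp: inversion_minimal_def)
  have inj: "inj u" "inj v" using assms(1,2) by (auto intro: permutes_inj)
  have perm: "u \<circ> transpose i j permutes {1..n}" "v \<circ> transpose i j permutes {1..n}"
    using assms(1,2) ij(1-3) by (blast intro: swap_permutes)+
  have dom: "dominated u v"
    using assms(3) by (auto simp: bruhat_less_def intro: bruhat_le_imp_dominated)
  note dich = inversion_minimal_dichotomy[OF inj assms(4)]
  have "bruhat_covers n u (u \<circ> transpose i j)"
    using assms(1) ij(1-4) by (rule bruhat_covers_swap) (use dich in force)
  moreover have "bruhat_covers n (v \<circ> transpose i j) (v \<circ> transpose i j \<circ> transpose i j)"
    using perm(2) ij(1-3)
  proof (rule bruhat_covers_swap)
    show "\<not> ((v \<circ> transpose i j) i < (v \<circ> transpose i j) m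
        \<and> (v \<circ> transpose i j) m < (v \<circ> transpose i j) j)" if "i < m" "m < j" for m
      using that dich[of m] by auto
  qed (use ij in simp)
  then have "bruhat_covers n (v \<circ> transpose i j) v" by (simp add: comp_assoc)
  ultimately show ?thesis
    using dominated_imp_bruhat_le[OF assms(1) perm(2) dominated_swap_upper[OF inj dom assms(4)]]
      dominated_imp_bruhat_le[OF perm(1) assms(2) dominated_swap_lower[OF inj dom assms(4)]]
    by blast
qed

end
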